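(* Consider any one of the four multinomial logit models with partial proportional odds, with true parameter value $\boldsymbol\theta_0\in\boldsymbol\Theta$ and true order $\sigma_0\in\mathcal P$, and i.i.d. observations $(X_l,Y_l)$, $l=1,2,\dots$, generated from it as described in the context. For each $N$, let $(\hat{\boldsymbol\theta}_N,\hat\sigma_N)\in\boldsymbol\Theta\times\mathcal P$ be a function of the first $N$ observations which is a maximum likelihood estimator, that is, almost surely, for all sufficiently large $N$, $(\hat{\boldsymbol\theta}_N,\hat\sigma_N)$ maximizes $l_N(\boldsymbol\theta,\sigma)$ over $\boldsymbol\Theta\times\mathcal P$. Then, as $N\to\infty$, $$N^{-1}\left|l_N(\hat{\boldsymbol\theta}_N,\hat\sigma_N)-l_N(\boldsymbol\theta_0,\sigma_0)\right|\to0\quad\text{almost surely.}$$ Furthermore, $N^{-1}l_N(\hat{\boldsymbol\theta}_N,\hat\sigma_N)\to l_0$ and $l_N(\boldsymbol\theta_0,\sigma_0)/l_N(\hat{\boldsymbol\theta}_N,\hat\sigma_N)\to1$ almost surely as well, where $l_0=\sum_{i=1}^m\sum_{j=1}^J\frac{n_i}{n}\pi_{ij}(\boldsymbol\theta_0)\log\pi_{ij}(\boldsymbol\theta_0)$.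
   Context: Models. Let $d\ge1$, $m\ge1$, $J\ge3$, and let $\mathbf x_1,\dots,\mathbf x_m\in\mathbb R^d$ be distinct. $\mathbf h_j:\mathbb R^d\to\mathbb R^{p_j}$ ($j=1,\dots,J-1$) and $\mathbf h_c:\mathbb R^d\to\mathbb R^{p_c}$ are known predictor functions, $\boldsymbol\theta=(\boldsymbol\beta_1^T,\dots,\boldsymbol\beta_{J-1}^T,\boldsymbol\zeta^T)^T\in\mathbb R^p$, $\boldsymbol\beta_j\in\mathbb R^{p_j}$, $\boldsymbol\zeta\in\mathbb R^{p_c}$, $p=p_1+\cdots+p_{J-1}+p_c$, and $\eta_{ij}(\boldsymbol\theta)=\mathbf h_j^T(\mathbf x_i)\boldsymbol\beta_j+\mathbf h_c^T(\mathbf x_i)\boldsymbol\zeta$. The four logit models with partial proportional odds are, for $j=1,\dots,J-1$, $i=1,\dots,m$: - baseline-category: $\log(\pi_{ij}/\pi_{iJ})=\eta_{ij}$; - cumulative: $\log\big((\pi_{i1}+\cdots+\pi_{ij})/(\pi_{i,j+1}+\cdots+\pi_{iJ})\big)=\eta_{ij}$; - adjacent-categories: $\log(\pi_{ij}/\pi_{i,j+1})=\eta_{ij}$; - continuation-ratio: $\log\big(\pi_{ij}/(\pi_{i,j+1}+\cdots+\pi_{iJ})\big)=\eta_{ij}$. The parameter space is $\boldsymbol\Theta=\{\boldsymbol\theta\in\mathbb R^p:\mathbf h_j^T(\mathbf x_i)\boldsymbol\beta_j<\mathbf h_{j+1}^T(\mathbf x_i)\boldsymbol\beta_{j+1},\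 j=1,\dots,J-2,\ i=1,\dots,m\}$ for the cumulative model and $\boldsymbol\Theta=\mathbb R^p$ for the other three. For $\boldsymbol\theta\in\boldsymbol\Theta$, $(\pi_{i1}(\boldsymbol\theta),\dots,\pi_{iJ}(\boldsymbol\theta))$ is the unique probability vector with positive entries satisfying the model equations at $\mathbf x_i$. $\mathcal P$ is the set of permutations of $\{1,\dots,J\}$. Sampling. $n_1,\dots,n_m$ are fixed positive integers and $n=\sum_{i=1}^mn_i$. The pairs $(X_l,Y_l)$, $l=1,2,\dots$, are i.i.d.; $X_l$ takes value $\mathbf x_i$ with probability $n_i/n$, and given $X_l=\mathbf x_i$, $Y_l$ takes value $j\in\{1,\dots,J\}$ with probability $\pi_{i\sigma_0^{-1}(j)}(\boldsymbol\theta_0)$. For given $N$, $Y_{ij}=\#\{l\le N:X_l=\mathbf x_i,\,Y_l=j\}$ (depending on $N$), and $$l_N(\boldsymbol\theta,\sigma)=\sum_{i=1}^m\sum_{j=1}^JY_{ij}\log\pi_{i\sigma^{-1}(j)}(\boldsymbol\theta),\qquad(\boldsymbol\theta,\sigma)\in\boldsymbol\Theta\times\mathcal P,$$ which is the log-likelihood up to an additive term not depending on $(\boldsymbol\theta,\sigma)$. *)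

theory Defs
  imports
    "HOL-Probability.Probability"
    "HOL-Combinatorics.Permutations"
    "Jordan_Normal_Form.Matrix"
begin

datatype logit_kind = Baseline | Cumulative | Adjacent | Continuation

record 'a logit_model =
  kind :: logit_kind
  ncat :: nat                           \<comment> \<open>J\<close>
  nsite :: nat                          \<comment> \<open>m\<close>
  site :: "nat \<Rightarrow> 'a"                   \<comment> \<open>x_i, used for i = 1..m\<close>
  dimh :: "nat \<Rightarrow> nat"                 \<comment> \<open>p_j, used for j = 1..J-1\<close>
  dimc :: nat                           \<comment> \<open>p_c\<close>
  hpred :: "nat \<Rightarrow> 'a \<Rightarrow> real vec"      \<comment> \<open>h_j\<close>
  hcom :: "'a \<Rightarrow> real vec"              \<comment> \<open>h_c\<close>

definition dimp :: "'a logit_model \<Rightarrow> nat" where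
  "dimp D = (\<Sum>j = 1..ncat D - 1. dimh D j) + dimc D"

text \<open>The blocks of \<open>\<theta> = (\<beta>_1, \<dots>, \<beta>_{J-1}, \<zeta>)\<close>. Entries of \<open>\<theta>\<close> are numbered from 0.\<close>

definition beta :: "'a logit_model \<Rightarrow> real vec \<Rightarrow> nat \<Rightarrow> real vec" where
  "beta D \<theta> j = vec (dimh D j) (\<lambda>k. vec_index \<theta> ((\<Sum>r = 1..<j. dimh D r) + k))"

definition zeta :: "'a logit_model \<Rightarrow> real vec \<Rightarrow> real vec" where
  "zeta D \<theta> = vec (dimc D) (\<lambda>k. vec_index \<theta> ((\<Sum>r = 1..<ncat D. dimh D r) + k))"

definition eta :: "'a logit_model \<Rightarrow> real vec \<Rightarrow> nat \<Rightarrow> nat \<Rightarrow> real" where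
  "eta D \<theta> i j = scalar_prod (hpred D j (site D i)) (beta D \<theta> j)
                + scalar_prod (hcom D (site D i)) (zeta D \<theta>)"

definition param_space :: "'a logit_model \<Rightarrow> real vec set" where
  "param_space D = {\<theta> \<in> carrier_vec (dimp D). kind D = Cumulative \<longrightarrow>
     (\<forall>j\<in>{1..ncat D - 2}. \<forall>i\<in>{1..nsite D}.
        scalar_prod (hpred D j (site D i)) (beta D \<theta> j)
          < scalar_prod (hpred D (j + 1) (site D i)) (beta D \<theta> (j + 1)))}"

fun odds :: "logit_kind \<Rightarrow> nat \<Rightarrow> (nat \<Rightarrow> real) \<Rightarrow> nat \<Rightarrow> real" where
  "odds Baseline J p j = p j / p J"
| "odds Cumulative J p j = (\<Sum>k = 1..j. p k) / (\<Sum>k = j + 1..J. p k)"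
| "odds Adjacent J p j = p j / p (j + 1)"
| "odds Continuation J p j = p j / (\<Sum>k = j + 1..J. p k)"

text \<open>The category probabilities \<open>\<pi>_{i1}(\<theta>), \<dots>, \<pi>_{iJ}(\<theta>)\<close>. Functions are taken extensional
  on \<open>{1..J}\<close> so that the description can be unique; for \<open>\<theta>\<close> outside \<^const>\<open>param_space\<close> the
  value may be unspecified.\<close>

definition catprob :: "'a logit_model \<Rightarrow> real vec \<Rightarrow> nat \<Rightarrow> nat \<Rightarrow> real" where
  "catprob D \<theta> i = (THE p. p \<in> {1..ncat D} \<rightarrow>\<^sub>E {0<..} \<and> (\<Sum>j = 1..ncat D. p j) = 1 \<and>
     (\<forall>j\<in>{1..ncat D - 1}. ln (odds (kind D) (ncat D) p j) = eta D \<theta> i j))"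

definition orders :: "'a logit_model \<Rightarrow> (nat \<Rightarrow> nat) set" where
  "orders D = {\<sigma>. \<sigma> permutes {1..ncat D}}"

text \<open>Below, \<open>xs l\<close> and \<open>ys l\<close> (\<open>l \<ge> 1\<close>) are the realized observations. The inverse permutation is
  written \<open>inv_into UNIV \<sigma>\<close>, because \<open>inv\<close> is here the HOL-Algebra group inverse.\<close>

definition cell_count ::
  "'a logit_model \<Rightarrow> (nat \<Rightarrow> 'a) \<Rightarrow> (nat \<Rightarrow> nat) \<Rightarrow> nat \<Rightarrow> nat \<Rightarrow> nat \<Rightarrow> nat" where
  "cell_count D xs ys N i j = card {l \<in> {1..N}. xs l = site D i \<and> ys l = j}"

definition loglik ::
  "'a logit_model \<Rightarrow> (nat \<Rightarrow> 'a) \<Rightarrow> (nat \<Rightarrow> nat) \<Rightarrow> nat \<Rightarrow> real vec \<times> (nat \<Rightarrow> nat) \<Rightarrow> real" where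
  "loglik D xs ys N = (\<lambda>(\<theta>, \<sigma>). \<Sum>i = 1..nsite D. \<Sum>j = 1..ncat D.
     real (cell_count D xs ys N i j) * ln (catprob D \<theta> i (inv_into UNIV \<sigma> j)))"

definition first_obs :: "(nat \<Rightarrow> 'a) \<Rightarrow> (nat \<Rightarrow> nat) \<Rightarrow> nat \<Rightarrow> ('a \<times> nat) list" where
  "first_obs xs ys N = map (\<lambda>l. (xs l, ys l)) [1..<Suc N]"

end

theory Submission
  imports Defs
begin

text \<open>
  The maximal log-likelihood is squeezed between two functions of the data that do not involve the
  estimator. Below, it dominates the log-likelihood at the true parameter and order. Above, since
  every candidate assigns a probability vector to each site, Gibbs' inequality bounds it by its value
  for the saturated model, where the conditional cell frequencies replace the category probabilities.
  By the strong law of large numbers the cell frequencies converge, so that both bounds, divided by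
  \<open>N\<close>, tend to the negative number \<open>l\<^sub>0\<close>.
\<close>

section \<open>Strong law of large numbers for bounded variables\<close>

text \<open>By Hoeffding's inequality a deviation of at least \<open>e\<close> of the sample mean
  from \<open>\<mu>\<close> has a probability that decays geometrically in the sample size, so
  Borel-Cantelli applies to each tolerance \<open>e\<close>. A common range and a common mean
  replace identical distribution.\<close>

lemma (in prob_space) strong_law_bounded:
  fixes Z :: "nat \<Rightarrow> 'a \<Rightarrow> real"
  assumes indep: "indep_vars (\<lambda>_. borel) Z {1..}"
    and bounded: "\<And>l. 1 \<le> l \<Longrightarrow> AE x in M. Z l x \<in> {a..b}" and "a < b"
    and mean: "\<And>l. 1 \<le> l \<Longrightarrow> expectation (Z l) = \<mu>"
  shows "AE x in M. (\<lambda>N. (\<Sum>l = 1..N. Z l x) / real N) \<longlonglongrightarrow> \<mu>"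
proof -
  have rv [measurable]: "random_variable borel (Z l)" if "1 \<le> l" for l
    using indep that unfolding indep_vars_def by auto
  have dev: "AE x in M. \<forall>\<^sub>F N in sequentially. \<bar>(\<Sum>l = 1..N. Z l x) / real N - \<mu>\<bar> < e"
    if "0 < e" for e :: real
  proof -
    \<comment> \<open>The event is multiplied through by \<open>N\<close> to match Hoeffding's
      inequality for sums. \<open>A 0\<close> is the whole space, which is harmless because
      \<open>bound\<close> starts at 1. \<open>r\<close> is the factor that each observation
      contributes to Hoeffding's bound.\<close>
    define A where "A N = {x \<in> space M. real N * e \<le> \<bar>(\<Sum>l = 1..N. Z l x) - real N * \<mu>\<bar>}" for N
    define r where "r = exp (- 2 * e\<^sup>2 / (b - a)\<^sup>2)"
    have r: "0 < r" "r < 1" using \<open>0 < e\<close> \<open>a < b\<close> by (simp_all add: r_def)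
    have meas: "A N \<in> events" for N
      unfolding A_def by measurable
    have bound: "prob (A N) \<le> 2 * r ^ N" if "1 \<le> N" for N
    proof -
      interpret Hoeffding_ineq M "{1..N}" Z "\<lambda>_. a" "\<lambda>_. b" "real N * \<mu>"
      proof unfold_locales
        show "indep_vars (\<lambda>_. borel) Z {1..N}"
          using indep by (rule indep_vars_subset) auto
        show "real N * \<mu> \<equiv> \<Sum>i = 1..N. expectation (Z i)"
          by (rule eq_reflection) (simp add: mean)
      qed (auto simp: bounded[simplified])
      have "prob (A N) \<le> 2 * exp (- 2 * (real N * e)\<^sup>2 / (\<Sum>i\<in>{1..N}. (b - a)\<^sup>2))"
        unfolding A_def by (rule Hoeffding_ineq_abs_ge) (use that \<open>0 < e\<close> \<open>a < b\<close> in auto)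
      \<comment> \<open>The \<open>N\<close> equal squared widths add up to
        \<open>N * (b - a)^2\<close>, which cancels one of the two factors \<open>N\<close> in the
        numerator and leaves an exponent linear in \<open>N\<close>.\<close>
      also have "- 2 * (real N * e)\<^sup>2 / (\<Sum>i\<in>{1..N}. (b - a)\<^sup>2) = real N * (- 2 * e\<^sup>2 / (b - a)\<^sup>2)"
        using that by (simp add: power_mult_distrib power2_eq_square[of "real N"] mult.left_commute)
      also have "exp \<dots> = r ^ N"
        unfolding r_def by (rule exp_of_nat_mult)
      finally show ?thesis .
    qed
    have "summable (\<lambda>N. prob (A N))"
    proof (rule summable_comparison_test')
      show "summable (\<lambda>N. 2 * r ^ N)" using r by (intro summable_mult summable_geometric) auto
      show "norm (prob (A N)) \<le> 2 * r ^ N" if "1 \<le> N" for N using bound[OF that] by simp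
    qed
    then have "AE x in M. \<forall>\<^sub>F N in sequentially. x \<in> space M - A N"
      using meas by (intro borel_cantelli_AE1) (auto simp: emeasure_eq_measure)
    then show ?thesis
    proof eventually_elim
      case (elim x)
      from elim eventually_ge_at_top[of 1] show ?case
      proof eventually_elim
        case (elim N)
        then have "\<bar>(\<Sum>l = 1..N. Z l x) - real N * \<mu>\<bar> < real N * e"
          by (auto simp: A_def)
        moreover have "(\<Sum>l = 1..N. Z l x) / real N - \<mu> = ((\<Sum>l = 1..N. Z l x) - real N * \<mu>) / real N"
          using elim by (simp add: field_simps)
        ultimately show ?case
          using elim by (simp add: field_simps)
      qed
    qed
  qed
  \<comment> \<open>Only countably many null sets may be joined, so the tolerances are restricted to
    \<open>1 / (k + 1)\<close>.\<close>
  have "AE x in M. \<forall>k. \<forall>\<^sub>F N in sequentially. \<bar>(\<Sum>l = 1..N. Z l x) / real N - \<mu>\<bar> < inverse (real (Suc k))"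
    by (subst AE_all_countable) (intro allI dev, simp)
  then show ?thesis
  proof eventually_elim
    case (elim x)
    show ?case
    proof (rule tendstoI)
      fix e :: real assume "0 < e"
      then obtain k where "inverse (real (Suc k)) < e" using reals_Archimedean by blast
      with elim[rule_format, of k]
      show "\<forall>\<^sub>F N in sequentially. dist ((\<Sum>l = 1..N. Z l x) / real N) \<mu> < e"
        by (auto simp: dist_real_def elim: eventually_mono)
    qed
  qed
qed

section \<open>Existence and uniqueness of the category probabilities\<close>

text \<open>This treats the baseline, adjacent and continuation links together: the denominator of
  the \<open>j\<close>-th odds is a sum over a nonempty set \<open>S j\<close> of categories after
  \<open>j\<close>. Each equation thus gives \<open>p j\<close> from later entries, so backward
  recursion from \<open>p J\<close> determines the vector up to a factor, and the total 1 fixes that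
  factor.\<close>

lemma ex1_prob_vector_tail_odds:
  fixes \<eta> :: "nat \<Rightarrow> real" and S :: "nat \<Rightarrow> nat set"
  assumes "1 \<le> J" and S: "\<And>j. j \<in> {1..J - 1} \<Longrightarrow> S j \<noteq> {} \<and> S j \<subseteq> {j + 1..J}"
  shows "\<exists>!p. p \<in> {1..J} \<rightarrow>\<^sub>E {0<..} \<and> (\<Sum>j = 1..J. p j) = 1 \<and>
           (\<forall>j\<in>{1..J - 1}. ln (p j / (\<Sum>k\<in>S j. p k)) = \<eta> j)"
proof -
  have tail_pos: "0 < (\<Sum>k\<in>S j. w k)"
    if "j \<in> {1..J - 1}" "\<And>k. k \<in> {j + 1..J} \<Longrightarrow> 0 < w k" for w :: "nat \<Rightarrow> real" and j
    using S[OF that(1)] that(2) by (intro sum_pos) (auto intro: finite_subset)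
  show ?thesis
  proof (rule ex_ex1I)
    \<comment> \<open>Unnormalized weights are built from the top, starting with weight 1 at
      \<open>J\<close>; \<open>t\<close> counts the equations solved so far. For
      \<open>t = 0\<close> the range \<open>{J..J - 1}\<close> is empty because
      \<open>1 \<le> J\<close>.\<close>
    have "\<exists>w :: nat \<Rightarrow> real. (\<forall>j\<in>{J - t..J}. 0 < w j) \<and>
            (\<forall>j\<in>{J - t..J - 1}. w j = exp (\<eta> j) * (\<Sum>k\<in>S j. w k))" if "t \<le> J - 1" for t
      using that
    proof (induction t)
      case 0
      then show ?case using \<open>1 \<le> J\<close> by (intro exI[of _ "\<lambda>_. 1"]) auto
    next
      case (Suc t)
      from Suc.IH[OF Suc_leD[OF Suc.prems]]
      obtain w :: "nat \<Rightarrow> real" where w: "\<And>j. j \<in> {J - t..J} \<Longrightarrow> 0 < w j"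
        "\<And>j. j \<in> {J - t..J - 1} \<Longrightarrow> w j = exp (\<eta> j) * (\<Sum>k\<in>S j. w k)" by blast
      define i where "i = J - Suc t"
      have i: "J - t = Suc i" "i \<in> {1..J - 1}" using Suc.prems by (auto simp: i_def)
      define v where "v = w(i := exp (\<eta> i) * (\<Sum>k\<in>S i. w k))"
      \<comment> \<open>Overwriting the weight at \<open>i\<close> disturbs no equation from
        \<open>i\<close> on, because \<open>S j\<close> lies strictly above
        \<open>j \<ge> i\<close>.\<close>
      have tail: "(\<Sum>k\<in>S j. v k) = (\<Sum>k\<in>S j. w k)" if "j \<in> {i..J - 1}" for j
      proof (rule sum.cong)
        fix k assume "k \<in> S j"
        then have "j < k" using S[of j] that i by auto
        then show "v k = w k" using that by (auto simp: v_def)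
      qed simp
      have "0 < v j" if "j \<in> {i..J}" for j
        using that w(1) i tail_pos[of i w] by (cases "j = i") (auto simp: v_def)
      moreover have "v j = exp (\<eta> j) * (\<Sum>k\<in>S j. v k)" if "j \<in> {i..J - 1}" for j
        using that w(2)[of j] i tail[of j] by (cases "j = i") (auto simp: v_def)
      ultimately show ?case unfolding i_def by blast
    qed
    moreover have one: "J - (J - 1) = 1" using \<open>1 \<le> J\<close> by simp
    ultimately obtain w :: "nat \<Rightarrow> real" where w: "\<And>j. j \<in> {1..J} \<Longrightarrow> 0 < w j"
        "\<And>j. j \<in> {1..J - 1} \<Longrightarrow> w j = exp (\<eta> j) * (\<Sum>k\<in>S j. w k)"
      by (metis order_refl)
    define W where "W = (\<Sum>j = 1..J. w j)"
    have W: "0 < W" unfolding W_def using w(1) \<open>1 \<le> J\<close> by (intro sum_pos) auto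
    \<comment> \<open>Normalization divides numerator and denominator of every odds by the same
      \<open>W\<close>, so the equations survive.\<close>
    define p where "p = (\<lambda>j\<in>{1..J}. w j / W)"
    have "ln (p j / (\<Sum>k\<in>S j. p k)) = \<eta> j" if j: "j \<in> {1..J - 1}" for j
    proof -
      have "(\<Sum>k\<in>S j. p k) = (\<Sum>k\<in>S j. w k) / W"
        unfolding sum_divide_distrib using S[OF j] by (intro sum.cong) (auto simp: p_def)
      moreover have "p j = w j / W" using j by (auto simp: p_def)
      moreover have "0 < (\<Sum>k\<in>S j. w k)" by (intro tail_pos[OF j] w(1)) (use j in auto)
      ultimately show ?thesis using w(2)[OF j] W by simp
    qed
    moreover have "(\<Sum>j = 1..J. p j) = 1"
      using W by (simp add: p_def W_def flip: sum_divide_distrib)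
    moreover have "p \<in> {1..J} \<rightarrow>\<^sub>E {0<..}" using w(1) W by (auto simp: p_def)
    ultimately show "\<exists>p. p \<in> {1..J} \<rightarrow>\<^sub>E {0<..} \<and> (\<Sum>j = 1..J. p j) = 1 \<and>
             (\<forall>j\<in>{1..J - 1}. ln (p j / (\<Sum>k\<in>S j. p k)) = \<eta> j)" by blast
  next
    fix p q :: "nat \<Rightarrow> real"
    assume "p \<in> {1..J} \<rightarrow>\<^sub>E {0<..} \<and> (\<Sum>j = 1..J. p j) = 1 \<and>
             (\<forall>j\<in>{1..J - 1}. ln (p j / (\<Sum>k\<in>S j. p k)) = \<eta> j)"
      and "q \<in> {1..J} \<rightarrow>\<^sub>E {0<..} \<and> (\<Sum>j = 1..J. q j) = 1 \<and>
             (\<forall>j\<in>{1..J - 1}. ln (q j / (\<Sum>k\<in>S j. q k)) = \<eta> j)"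
    then have p: "p \<in> {1..J} \<rightarrow>\<^sub>E {0<..}" "(\<Sum>j = 1..J. p j) = 1"
        "\<And>j. j \<in> {1..J - 1} \<Longrightarrow> ln (p j / (\<Sum>k\<in>S j. p k)) = \<eta> j"
      and q: "q \<in> {1..J} \<rightarrow>\<^sub>E {0<..}" "(\<Sum>j = 1..J. q j) = 1"
        "\<And>j. j \<in> {1..J - 1} \<Longrightarrow> ln (q j / (\<Sum>k\<in>S j. q k)) = \<eta> j" by auto
    have rec: "u j = exp (\<eta> j) * (\<Sum>k\<in>S j. u k)"
      if "u \<in> {1..J} \<rightarrow>\<^sub>E {0<..}" "j \<in> {1..J - 1}" "ln (u j / (\<Sum>k\<in>S j. u k)) = \<eta> j"
      for u :: "nat \<Rightarrow> real" and j
    proof -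
      have pos: "0 < u k" if "k \<in> {1..J}" for k using that \<open>u \<in> _\<close> by auto
      have "0 < u j" "0 < (\<Sum>k\<in>S j. u k)"
        using that(2) by (auto intro!: pos tail_pos[OF that(2)])
      then have "exp (\<eta> j) = u j / (\<Sum>k\<in>S j. u k)"
        using that(3) by (metis divide_pos_pos exp_ln)
      then show ?thesis using \<open>0 < (\<Sum>k\<in>S j. u k)\<close> by simp
    qed
    \<comment> \<open>Two solutions obey the same homogeneous recursion, hence are proportional;
      downward induction on \<open>j\<close> shows it in a form free of division. Summing over
      \<open>j\<close> then gives \<open>p J = q J\<close>, and with it equality everywhere.\<close>
    have cross: "p j * q J = q j * p J" if "j \<in> {1..J}" for j
      using that
    proof (induction "J - j" arbitrary: j rule: less_induct)
      case less
      show ?case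
      proof (cases "j = J")
        case False
        then have j: "j \<in> {1..J - 1}" using less.prems by auto
        have "(\<Sum>k\<in>S j. p k) * q J = (\<Sum>k\<in>S j. q k) * p J"
          unfolding sum_distrib_right
        proof (rule sum.cong)
          fix k assume "k \<in> S j"
          then have "k \<in> {j + 1..J}" using S[OF j] by blast
          then show "p k * q J = q k * p J" by (intro less.hyps) auto
        qed simp
        then show ?thesis
          using rec[OF p(1) j p(3)[OF j]] rec[OF q(1) j q(3)[OF j]] by (simp add: mult.assoc)
      qed simp
    qed
    have "(\<Sum>j = 1..J. p j) * q J = (\<Sum>j = 1..J. q j) * p J"
      unfolding sum_distrib_right using cross by (intro sum.cong) auto
    then have "q J = p J" using p(2) q(2) by simp
    moreover have "0 < p J" using p(1) \<open>1 \<le> J\<close> by auto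
    ultimately have "p j = q j" if "j \<in> {1..J}" for j using cross[OF that] by simp
    then show "p = q" using p(1) q(1) by (intro PiE_ext) auto
  qed
qed

text \<open>The equations say that each partial sum up to \<open>j\<close> is the logistic function
  at \<open>\<eta> j\<close>, so the entries must be the successive differences of these values.
  Strict increase of \<open>\<eta>\<close> makes the differences positive.\<close>

lemma ex1_prob_vector_cumulative_odds:
  fixes \<eta> :: "nat \<Rightarrow> real"
  assumes "1 \<le> J" and mono: "\<And>j. j \<in> {1..J - 2} \<Longrightarrow> \<eta> j < \<eta> (j + 1)"
  shows "\<exists>!p. p \<in> {1..J} \<rightarrow>\<^sub>E {0<..} \<and> (\<Sum>j = 1..J. p j) = 1 \<and>
           (\<forall>j\<in>{1..J - 1}. ln ((\<Sum>k = 1..j. p k) / (\<Sum>k = j + 1..J. p k)) = \<eta> j)"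
proof -
  \<comment> \<open>The boundary values 0 at 0 and 1 from \<open>J\<close> on let the formula
    \<open>F j - F (j - 1)\<close> cover the first and the last category too.\<close>
  define F where "F j = (if j = 0 then 0 else if J \<le> j then 1 else 1 / (1 + exp (- \<eta> j)))" for j
  have pos1: "0 < 1 + exp (x :: real)" for x by (simp add: add_pos_pos)
  have split_sum: "(\<Sum>k = 1..J. p k) = (\<Sum>k = 1..j. p k) + (\<Sum>k = j + 1..J. p k)" if "j \<le> J"
    for p :: "nat \<Rightarrow> real" and j
    using sum.ub_add_nat[of 1 j p "J - j"] that by simp
  show ?thesis
  proof (rule ex_ex1I)
    define p where "p = (\<lambda>j\<in>{1..J}. F j - F (j - 1))"
    have cum: "(\<Sum>k = 1..j. p k) = F j" if "j \<le> J" for j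
      using that by (induction j) (auto simp: p_def F_def)
    have "0 < p j" if "j \<in> {1..J}" for j
    proof -
      have "F (j - 1) < F j"
      \<comment> \<open>At the ends a logistic value is compared with 0 or 1 (or 0 with 1, if
        \<open>J = 1\<close>); only between them does the monotonicity of \<open>\<eta>\<close>
        enter.\<close>
      proof (cases "j - 1 = 0 \<or> j = J")
        case True
        then show ?thesis using that pos1[of "- \<eta> j"] pos1[of "- \<eta> (j - 1)"]
          by (auto simp: F_def)
      next
        case False
        then have "j - 1 \<in> {1..J - 2}" "j - 1 + 1 = j" using that by auto
        then have "\<eta> (j - 1) < \<eta> j" using mono[of "j - 1"] by simp
        then show ?thesis using False that pos1[of "- \<eta> j"]
          by (auto simp: F_def intro!: divide_strict_left_mono mult_pos_pos pos1)
      qed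
      then show ?thesis using that by (simp add: p_def)
    qed
    moreover have "(\<Sum>j = 1..J. p j) = 1" using cum[of J] \<open>1 \<le> J\<close> by (simp add: F_def)
    moreover have "ln ((\<Sum>k = 1..j. p k) / (\<Sum>k = j + 1..J. p k)) = \<eta> j" if "j \<in> {1..J - 1}" for j
    proof -
      have "(\<Sum>k = 1..j. p k) = F j" "(\<Sum>k = j + 1..J. p k) = 1 - F j"
        using cum[of j] cum[of J] split_sum[of j p] that by (auto simp: F_def)
      moreover have "F j / (1 - F j) = exp (\<eta> j)"
        using that pos1[of "- \<eta> j"] by (auto simp: F_def exp_minus divide_simps)
      ultimately show ?thesis by simp
    qed
    moreover have "p \<in> extensional {1..J}" by (simp add: p_def)
    ultimately show "\<exists>p. p \<in> {1..J} \<rightarrow>\<^sub>E {0<..} \<and> (\<Sum>j = 1..J. p j) = 1 \<and>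
           (\<forall>j\<in>{1..J - 1}. ln ((\<Sum>k = 1..j. p k) / (\<Sum>k = j + 1..J. p k)) = \<eta> j)"
      by (intro exI[of _ p]) (auto simp: PiE_def)
  next
    have char: "p j = F j - F (j - 1)" if "p \<in> {1..J} \<rightarrow>\<^sub>E {0<..} \<and> (\<Sum>j = 1..J. p j) = 1 \<and>
           (\<forall>j\<in>{1..J - 1}. ln ((\<Sum>k = 1..j. p k) / (\<Sum>k = j + 1..J. p k)) = \<eta> j)"
        and "j \<in> {1..J}" for p and j
    proof -
      have p: "\<And>k. k \<in> {1..J} \<Longrightarrow> 0 < p k" "(\<Sum>j = 1..J. p j) = 1"
        "\<And>j. j \<in> {1..J - 1} \<Longrightarrow> ln ((\<Sum>k = 1..j. p k) / (\<Sum>k = j + 1..J. p k)) = \<eta> j"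
        using that(1) by auto
      \<comment> \<open>For \<open>0 < i < J\<close> the upper sum is 1 minus the lower one, so the
        odds equation is solved for the lower sum. The two ends are the empty sum and the
        total.\<close>
      have cum: "(\<Sum>k = 1..i. p k) = F i" if "i \<le> J" for i
      proof (cases "i = 0 \<or> i = J")
        case True
        then show ?thesis using p(2) by (auto simp: F_def)
      next
        case False
        then have i: "i \<in> {1..J - 1}" using that by auto
        let ?A = "\<Sum>k = 1..i. p k" and ?B = "\<Sum>k = i + 1..J. p k"
        have "0 < ?A" "0 < ?B" using i by (auto intro!: sum_pos p(1))
        moreover from this have "?A / ?B = exp (\<eta> i)"
          using p(3)[OF i] by (metis divide_pos_pos exp_ln)
        moreover have "?B = 1 - ?A" using split_sum[of i p] that p(2) by simp
        ultimately have "exp (- \<eta> i) = (1 - ?A) / ?A"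
          by (metis exp_minus inverse_divide)
        then have "(1 + exp (- \<eta> i)) * ?A = 1" using \<open>0 < ?A\<close> by (simp add: field_simps)
        then have "1 / (1 + exp (- \<eta> i)) = ?A"
          using pos1[of "- \<eta> i"] by (simp add: divide_eq_eq mult.commute)
        then show ?thesis using i by (auto simp: F_def)
      qed
      show ?thesis using cum[of j] cum[of "j - 1"] that(2) by (cases j) auto
    qed
    fix p q assume pq: "p \<in> {1..J} \<rightarrow>\<^sub>E {0<..} \<and> (\<Sum>j = 1..J. p j) = 1 \<and>
           (\<forall>j\<in>{1..J - 1}. ln ((\<Sum>k = 1..j. p k) / (\<Sum>k = j + 1..J. p k)) = \<eta> j)"
      "q \<in> {1..J} \<rightarrow>\<^sub>E {0<..} \<and> (\<Sum>j = 1..J. q j) = 1 \<and>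
           (\<forall>j\<in>{1..J - 1}. ln ((\<Sum>k = 1..j. q k) / (\<Sum>k = j + 1..J. q k)) = \<eta> j)"
    then have "p \<in> {1..J} \<rightarrow>\<^sub>E {0<..}" "q \<in> {1..J} \<rightarrow>\<^sub>E {0<..}" by blast+
    then show "p = q" using char[OF pq(1)] char[OF pq(2)] by (intro PiE_ext) auto
  qed
qed

text \<open>The definite description in \<open>catprob\<close> can be used only after existence and
  uniqueness are known for each link; this lemma discharges that for all four.\<close>

lemma catprob_props:
  assumes "1 \<le> ncat D" "\<theta> \<in> param_space D" "i \<in> {1..nsite D}"
  shows "catprob D \<theta> i \<in> {1..ncat D} \<rightarrow>\<^sub>E {0<..}" "(\<Sum>j = 1..ncat D. catprob D \<theta> i j) = 1"
proof -
  let ?J = "ncat D"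
  have "\<exists>!p. p \<in> {1..?J} \<rightarrow>\<^sub>E {0<..} \<and> (\<Sum>j = 1..?J. p j) = 1 \<and>
     (\<forall>j\<in>{1..?J - 1}. ln (odds (kind D) ?J p j) = eta D \<theta> i j)"
  proof (cases "kind D")
    case Baseline
    have "{?J} \<noteq> {} \<and> {?J} \<subseteq> {j + 1..?J}" if "j \<in> {1..?J - 1}" for j
      using that by auto
    from ex1_prob_vector_tail_odds[OF assms(1) this, of "eta D \<theta> i"] show ?thesis
      by (simp add: Baseline)
  next
    case Cumulative
    \<comment> \<open>The \<open>zeta\<close> term does not depend on \<open>j\<close> and cancels,
      so the order restriction in \<open>param_space\<close> is exactly monotonicity of
      \<open>eta\<close> in \<open>j\<close>.\<close>
    then have "eta D \<theta> i j < eta D \<theta> i (j + 1)" if "j \<in> {1..?J - 2}" for j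
      using assms(2,3) that by (auto simp: param_space_def eta_def)
    then show ?thesis
      using ex1_prob_vector_cumulative_odds[of ?J "eta D \<theta> i"] assms(1) Cumulative by simp
  next
    case Adjacent
    have "{j + 1} \<noteq> {} \<and> {j + 1} \<subseteq> {j + 1..?J}" if "j \<in> {1..?J - 1}" for j
      using that by auto
    from ex1_prob_vector_tail_odds[OF assms(1) this, of "eta D \<theta> i"] show ?thesis
      by (simp add: Adjacent)
  next
    case Continuation
    have "{j + 1..?J} \<noteq> {} \<and> {j + 1..?J} \<subseteq> {j + 1..?J}" if "j \<in> {1..?J - 1}" for j
      using that by auto
    from ex1_prob_vector_tail_odds[OF assms(1) this, of "eta D \<theta> i"] show ?thesis
      by (simp add: Continuation)
  qed
  from theI'[OF this, folded catprob_def]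
  show "catprob D \<theta> i \<in> {1..?J} \<rightarrow>\<^sub>E {0<..}" "(\<Sum>j = 1..?J. catprob D \<theta> i j) = 1" by blast+
qed

section \<open>Gibbs' inequality, limiting frequencies and the saturated upper bound\<close>

text \<open>At a cell with \<open>q j = 0\<close> both terms vanish, so Isabelle's value of \<open>ln 0\<close> does not matter.\<close>

lemma gibbs_ineq:
  fixes p q :: "'a \<Rightarrow> real"
  assumes "finite A" and p: "\<And>j. j \<in> A \<Longrightarrow> 0 < p j" "sum p A = 1"
    and q: "\<And>j. j \<in> A \<Longrightarrow> 0 \<le> q j"
  shows "(\<Sum>j\<in>A. q j * ln (p j)) \<le> (\<Sum>j\<in>A. q j * ln (q j / sum q A))"
proof -
  \<comment> \<open>This is \<open>ln x \<le> x - 1\<close> at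
    \<open>x = p j * sum q A / q j\<close>, multiplied by \<open>q j\<close>. The right sides sum to
    0 because \<open>p\<close> has total 1; \<open>q\<close> may have any total.\<close>
  have "q j * ln (p j) - q j * ln (q j / sum q A) \<le> p j * sum q A - q j" if j: "j \<in> A" for j
  proof (cases "q j = 0")
    case True
    then show ?thesis using p(1)[OF j] q by (simp add: sum_nonneg)
  next
    case False
    then have "0 < q j" using q[OF j] by simp
    moreover have "q j \<le> sum q A" using \<open>finite A\<close> j q by (intro member_le_sum) auto
    ultimately have pos: "0 < q j" "0 < sum q A" by auto
    have "ln (p j) - ln (q j / sum q A) = ln (p j * sum q A / q j)"
      using pos p(1)[OF j] by (simp add: ln_div ln_mult)
    also have "\<dots> \<le> p j * sum q A / q j - 1"
      using pos p(1)[OF j] by (intro ln_le_minus_one) simp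
    finally have "q j * (ln (p j) - ln (q j / sum q A)) \<le> q j * (p j * sum q A / q j - 1)"
      using pos by (intro mult_left_mono) auto
    then show ?thesis using pos by (simp add: algebra_simps)
  qed
  then have "(\<Sum>j\<in>A. q j * ln (p j) - q j * ln (q j / sum q A)) \<le> (\<Sum>j\<in>A. p j * sum q A - q j)"
    by (rule sum_mono)
  also have "\<dots> = 0" using p(2) by (simp add: sum_subtractf flip: sum_distrib_right)
  finally show ?thesis by (simp add: sum_subtractf)
qed

text \<open>The count is a sum of independent indicators with values in \<open>[0, 1]\<close> and
  mean \<open>p\<close>.\<close>

lemma (in prob_space) strong_law_frequency:
  fixes W :: "nat \<Rightarrow> 'a \<Rightarrow> 'b"
  assumes indep: "indep_vars (\<lambda>_. K) W {1..}" and A: "A \<in> sets K"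
    and p: "\<And>l. 1 \<le> l \<Longrightarrow> \<P>(\<omega> in M. W l \<omega> \<in> A) = p"
  shows "AE \<omega> in M. (\<lambda>N. real (card {l \<in> {1..N}. W l \<omega> \<in> A}) / real N) \<longlonglongrightarrow> p"
proof -
  define Z where "Z l \<omega> = (indicator A (W l \<omega>) :: real)" for l \<omega>
  have "AE \<omega> in M. (\<lambda>N. (\<Sum>l = 1..N. Z l \<omega>) / real N) \<longlonglongrightarrow> p"
  proof (rule strong_law_bounded[where a = 0 and b = 1])
    show "indep_vars (\<lambda>_. borel) Z {1..}"
      unfolding Z_def by (rule indep_vars_compose2[OF indep]) (use A in measurable)
    show "expectation (Z l) = p" if "1 \<le> l" for l
    proof -
      have "expectation (Z l) = expectation (indicator {\<omega> \<in> space M. W l \<omega> \<in> A})"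
        by (intro Bochner_Integration.integral_cong) (auto simp: Z_def indicator_def)
      also have "\<dots> = prob ({\<omega> \<in> space M. W l \<omega> \<in> A} \<inter> space M)"
        by (rule Bochner_Integration.integral_indicator)
      also have "{\<omega> \<in> space M. W l \<omega> \<in> A} \<inter> space M = {\<omega> \<in> space M. W l \<omega> \<in> A}"
        by blast
      finally show ?thesis using p[OF that] by simp
    qed
  qed (auto simp: Z_def indicator_def)
  moreover have "(\<Sum>l = 1..N. Z l \<omega>) = real (card {l \<in> {1..N}. W l \<omega> \<in> A})" for N \<omega>
  proof -
    have "(\<Sum>l = 1..N. Z l \<omega>) = (\<Sum>l\<in>{l \<in> {1..N}. W l \<omega> \<in> A}. 1)"
      by (rule sum.mono_neutral_cong_right) (auto simp: Z_def)
    then show ?thesis by simp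
  qed
  ultimately show ?thesis by simp
qed

lemma catprob_order_props:
  assumes "1 \<le> ncat D" "\<theta> \<in> param_space D" "\<sigma> \<in> orders D" "i \<in> {1..nsite D}"
  shows "\<And>j. j \<in> {1..ncat D} \<Longrightarrow> 0 < catprob D \<theta> i (inv_into UNIV \<sigma> j)"
    and "(\<Sum>j = 1..ncat D. catprob D \<theta> i (inv_into UNIV \<sigma> j)) = 1"
proof -
  have perm: "inv_into UNIV \<sigma> permutes {1..ncat D}"
    using assms(3) by (simp add: orders_def permutes_inv)
  note props = catprob_props[OF assms(1,2,4)]
  show "0 < catprob D \<theta> i (inv_into UNIV \<sigma> j)" if "j \<in> {1..ncat D}" for j
    using props(1) permutes_in_image[OF perm, of j] that by (auto simp: PiE_iff)
  show "(\<Sum>j = 1..ncat D. catprob D \<theta> i (inv_into UNIV \<sigma> j)) = 1"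
    using sum.permute[OF perm, of "catprob D \<theta> i"] props(2) by (simp add: o_def)
qed

text \<open>Gibbs' inequality is applied at each site to the joint frequencies, whose normalization
  over categories gives the conditional ones. The bound is free of \<open>\<tau>\<close>. A site
  without observations contributes 0 to both sides, and so does every site when
  \<open>N = 0\<close>, as division by 0 yields 0.\<close>

lemma loglik_le_empirical:
  fixes D :: "'a logit_model" and xs :: "nat \<Rightarrow> 'a" and ys :: "nat \<Rightarrow> nat" and N :: nat
  assumes "1 \<le> ncat D" "\<tau> \<in> param_space D \<times> orders D"
  defines "q \<equiv> \<lambda>i j. real (cell_count D xs ys N i j) / real N"
  shows "loglik D xs ys N \<tau> / real N
           \<le> (\<Sum>i = 1..nsite D. \<Sum>j = 1..ncat D. q i j * ln (q i j / (\<Sum>k = 1..ncat D. q i k)))"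
proof -
  obtain \<theta> \<sigma> where \<tau>: "\<tau> = (\<theta>, \<sigma>)" "\<theta> \<in> param_space D" "\<sigma> \<in> orders D"
    using assms(2) by auto
  have "loglik D xs ys N \<tau> / real N
      = (\<Sum>i = 1..nsite D. \<Sum>j = 1..ncat D. q i j * ln (catprob D \<theta> i (inv_into UNIV \<sigma> j)))"
    by (simp add: loglik_def \<tau>(1) q_def sum_divide_distrib)
  also have "\<dots> \<le> (\<Sum>i = 1..nsite D. \<Sum>j = 1..ncat D. q i j * ln (q i j / (\<Sum>k = 1..ncat D. q i k)))"
    using catprob_order_props[OF assms(1) \<tau>(2,3)]
    by (intro sum_mono gibbs_ineq) (auto simp: q_def)
  finally show ?thesis .
qed

section \<open>Almost sure limits of the maximal log-likelihood\<close>

theorem theorem3p1: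
  fixes D :: "(real ^ 'd) logit_model"
    and n :: "nat \<Rightarrow> nat"
    and \<theta>\<^sub>0 :: "real vec" and \<sigma>\<^sub>0 :: "nat \<Rightarrow> nat"
    and M :: "'w measure"
    and X :: "nat \<Rightarrow> 'w \<Rightarrow> real ^ 'd" and Y :: "nat \<Rightarrow> 'w \<Rightarrow> nat"
    and est :: "nat \<Rightarrow> ((real ^ 'd) \<times> nat) list \<Rightarrow> real vec \<times> (nat \<Rightarrow> nat)"
  defines "obsX \<equiv> (\<lambda>\<omega> l. X l \<omega>)" and "obsY \<equiv> (\<lambda>\<omega> l. Y l \<omega>)"
  defines "ntot \<equiv> (\<Sum>i = 1..nsite D. n i)"
  defines "mle \<equiv> (\<lambda>N \<omega>. est N (first_obs (obsX \<omega>) (obsY \<omega>) N))"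
  defines "lN \<equiv> (\<lambda>N \<omega>. loglik D (obsX \<omega>) (obsY \<omega>) N)"
  defines "l0 \<equiv> (\<Sum>i = 1..nsite D. \<Sum>j = 1..ncat D.
             real (n i) / real ntot * catprob D \<theta>\<^sub>0 i j * ln (catprob D \<theta>\<^sub>0 i j))"
  assumes "1 \<le> nsite D" and "3 \<le> ncat D"
    and "inj_on (site D) {1..nsite D}"
    and "\<And>j x. j \<in> {1..ncat D - 1} \<Longrightarrow> hpred D j x \<in> carrier_vec (dimh D j)"
    and "\<And>x. hcom D x \<in> carrier_vec (dimc D)"
    and "\<theta>\<^sub>0 \<in> param_space D" and "\<sigma>\<^sub>0 \<in> orders D"
    and "\<And>i. i \<in> {1..nsite D} \<Longrightarrow> 0 < n i"
    and "prob_space M"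
    and "prob_space.indep_vars M (\<lambda>_. borel \<Otimes>\<^sub>M count_space UNIV) (\<lambda>l \<omega>. (X l \<omega>, Y l \<omega>)) {1..}"
    and "\<And>l i. \<lbrakk>1 \<le> l; i \<in> {1..nsite D}\<rbrakk> \<Longrightarrow>
           \<P>(\<omega> in M. X l \<omega> = site D i) = real (n i) / real ntot"
    and "\<And>l i j. \<lbrakk>1 \<le> l; i \<in> {1..nsite D}; j \<in> {1..ncat D}\<rbrakk> \<Longrightarrow>
           \<P>(\<omega> in M. Y l \<omega> = j \<bar> X l \<omega> = site D i) = catprob D \<theta>\<^sub>0 i (inv_into UNIV \<sigma>\<^sub>0 j)"
    and "\<And>N \<omega>. \<omega> \<in> space M \<Longrightarrow> mle N \<omega> \<in> param_space D \<times> orders D"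
    and "AE \<omega> in M. \<forall>\<^sub>F N in sequentially.
           \<forall>\<tau> \<in> param_space D \<times> orders D. lN N \<omega> \<tau> \<le> lN N \<omega> (mle N \<omega>)"
  shows "(AE \<omega> in M. (\<lambda>N. \<bar>lN N \<omega> (mle N \<omega>) - lN N \<omega> (\<theta>\<^sub>0, \<sigma>\<^sub>0)\<bar> / real N) \<longlonglongrightarrow> 0) \<and>
         (AE \<omega> in M. (\<lambda>N. lN N \<omega> (mle N \<omega>) / real N) \<longlonglongrightarrow> l0) \<and>
         (AE \<omega> in M. (\<lambda>N. lN N \<omega> (\<theta>\<^sub>0, \<sigma>\<^sub>0) / lN N \<omega> (mle N \<omega>)) \<longlonglongrightarrow> 1)"
proof -
  note D = assms(7,8) and \<theta>\<^sub>0 = assms(12) and \<sigma>\<^sub>0 = assms(13)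
    and n_pos = assms(14) and indep = assms(16) and margX = assms(17) and condY = assms(18)
    and mle = assms(19) and maximal = assms(20)
  interpret prob_space M by (rule assms(15))
  have J: "1 \<le> ncat D" using D by simp
  define \<pi> where "\<pi> i j = catprob D \<theta>\<^sub>0 i (inv_into UNIV \<sigma>\<^sub>0 j)" for i j
  define w where "w i = real (n i) / real ntot" for i
  have \<pi>: "\<And>j. j \<in> {1..ncat D} \<Longrightarrow> 0 < \<pi> i j" "(\<Sum>j = 1..ncat D. \<pi> i j) = 1"
    if "i \<in> {1..nsite D}" for i
    unfolding \<pi>_def using catprob_order_props[OF J \<theta>\<^sub>0 \<sigma>\<^sub>0 that] by auto
  have w: "0 < w i" if "i \<in> {1..nsite D}" for i
  proof -
    have "n i \<le> ntot" unfolding ntot_def using that by (intro member_le_sum) auto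
    then show ?thesis using n_pos[OF that] by (simp add: w_def)
  qed
  \<comment> \<open>\<open>l0\<close> is stated in the model's labels, the data come in labels
    permuted by \<open>\<sigma>\<^sub>0\<close>; reindexing the inner sum by the inverse permutation
    identifies the two.\<close>
  have l0: "l0 = (\<Sum>i = 1..nsite D. \<Sum>j = 1..ncat D. w i * \<pi> i j * ln (\<pi> i j))"
  proof -
    have perm: "inv_into UNIV \<sigma>\<^sub>0 permutes {1..ncat D}"
      using \<sigma>\<^sub>0 by (simp add: orders_def permutes_inv)
    show ?thesis
      unfolding l0_def w_def \<pi>_def
      by (rule sum.cong[OF refl], rule trans[OF sum.permute[OF perm]]) (simp add: o_def)
  qed
  \<comment> \<open>The limit of the quotient needs a nonzero denominator. With at least two
    categories of positive probability each one has probability below 1, so every summand is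
    strictly negative.\<close>
  have "l0 < 0"
  proof -
    have "\<pi> i j < 1" if "i \<in> {1..nsite D}" "j \<in> {1..ncat D}" for i j
    proof -
      define k :: nat where "k = (if j = 1 then 2 else 1)"
      have k: "k \<in> {1..ncat D}" "k \<noteq> j"
        using D by (auto simp: k_def)
      have "\<pi> i j + \<pi> i k = (\<Sum>l\<in>{j, k}. \<pi> i l)" using k by simp
      also have "\<dots> \<le> (\<Sum>l = 1..ncat D. \<pi> i l)"
        using k that \<pi>(1)[OF that(1)] by (intro sum_mono2) (auto intro: less_imp_le)
      finally show ?thesis using \<pi>(1)[OF that(1) k(1)] \<pi>(2)[OF that(1)] by simp
    qed
    then have "0 < - (w i * \<pi> i j * ln (\<pi> i j))"
      if "i \<in> {1..nsite D}" "j \<in> {1..ncat D}" for i j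
      using that w \<pi>(1) by (simp add: mult_pos_neg)
    then have "0 < (\<Sum>i = 1..nsite D. \<Sum>j = 1..ncat D. - (w i * \<pi> i j * ln (\<pi> i j)))"
      using D by (intro sum_pos) auto
    then show ?thesis by (simp add: l0 sum_negf)
  qed
  have freq: "AE \<omega> in M. (\<lambda>N. real (cell_count D (obsX \<omega>) (obsY \<omega>) N i j) / real N) \<longlonglongrightarrow> w i * \<pi> i j"
    if ij: "i \<in> {1..nsite D}" "j \<in> {1..ncat D}" for i j
  proof -
    have "AE \<omega> in M. (\<lambda>N. real (card {l \<in> {1..N}. (X l \<omega>, Y l \<omega>) \<in> {site D i} \<times> {j}}) / real N)
            \<longlonglongrightarrow> w i * \<pi> i j"
    proof (rule strong_law_frequency[OF indep])
      show "{site D i} \<times> {j} \<in> sets (borel \<Otimes>\<^sub>M count_space UNIV)"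
        by (rule pair_measureI) auto
      show "\<P>(\<omega> in M. (X l \<omega>, Y l \<omega>) \<in> {site D i} \<times> {j}) = w i * \<pi> i j" if "1 \<le> l" for l
      proof -
        \<comment> \<open>The conditional probability is a quotient by \<open>w i\<close>;
          positivity of \<open>w i\<close> allows it to be turned into the joint cell
          probability.\<close>
        have "\<P>(\<omega> in M. Y l \<omega> = j \<and> X l \<omega> = site D i) / w i = \<pi> i j"
          using condY[OF that ij] margX[OF that ij(1)] by (simp add: cond_prob_def \<pi>_def w_def)
        then have "\<P>(\<omega> in M. Y l \<omega> = j \<and> X l \<omega> = site D i) = w i * \<pi> i j"
          using w[OF ij(1)] by (auto simp: divide_eq_eq mult.commute)
        then show ?thesis by (simp add: conj_commute)
      qed
    qed
    then show ?thesis by (simp add: cell_count_def obsX_def obsY_def)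
  qed
  \<comment> \<open>All almost sure facts are gathered here, so that the rest is about deterministic
    sequences. Maximality enters as the comparison with the true parameter and order.\<close>
  define good where "good \<omega> \<longleftrightarrow> (\<forall>i\<in>{1..nsite D}. \<forall>j\<in>{1..ncat D}.
      (\<lambda>N. real (cell_count D (obsX \<omega>) (obsY \<omega>) N i j) / real N) \<longlonglongrightarrow> w i * \<pi> i j) \<and>
      (\<forall>N. mle N \<omega> \<in> param_space D \<times> orders D) \<and>
      (\<forall>\<^sub>F N in sequentially. lN N \<omega> (\<theta>\<^sub>0, \<sigma>\<^sub>0) \<le> lN N \<omega> (mle N \<omega>))" for \<omega>
  have AE_good: "AE \<omega> in M. good \<omega>"
  proof -
    have "AE \<omega> in M. \<forall>i\<in>{1..nsite D}. \<forall>j\<in>{1..ncat D}.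
        (\<lambda>N. real (cell_count D (obsX \<omega>) (obsY \<omega>) N i j) / real N) \<longlonglongrightarrow> w i * \<pi> i j"
      by (intro AE_finite_allI freq) auto
    with maximal AE_space show ?thesis
    proof eventually_elim
      case (elim \<omega>)
      have "\<forall>\<^sub>F N in sequentially. lN N \<omega> (\<theta>\<^sub>0, \<sigma>\<^sub>0) \<le> lN N \<omega> (mle N \<omega>)"
        using elim(1) by eventually_elim (use \<theta>\<^sub>0 \<sigma>\<^sub>0 in blast)
      with elim mle show ?case unfolding good_def by blast
    qed
  qed
  \<comment> \<open>At the truth the normalized log-likelihood is a fixed linear combination of the
    cell frequencies, so its limit is taken term by term.\<close>
  have true_lim: "(\<lambda>N. lN N \<omega> (\<theta>\<^sub>0, \<sigma>\<^sub>0) / real N) \<longlonglongrightarrow> l0" if "good \<omega>" for \<omega>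
  proof -
    have "(\<lambda>N. \<Sum>i = 1..nsite D. \<Sum>j = 1..ncat D.
             real (cell_count D (obsX \<omega>) (obsY \<omega>) N i j) / real N * ln (\<pi> i j)) \<longlonglongrightarrow> l0"
      unfolding l0 using that by (intro tendsto_sum tendsto_mult_right) (auto simp: good_def)
    then show ?thesis by (simp add: lN_def loglik_def \<pi>_def sum_divide_distrib)
  qed
  have mle_lim: "(\<lambda>N. lN N \<omega> (mle N \<omega>) / real N) \<longlonglongrightarrow> l0" if "good \<omega>" for \<omega>
  proof (rule tendsto_sandwich[OF _ _ true_lim[OF that]])
    define q where "q N i j = real (cell_count D (obsX \<omega>) (obsY \<omega>) N i j) / real N" for N i j
    have q: "(\<lambda>N. q N i j) \<longlonglongrightarrow> w i * \<pi> i j" if "i \<in> {1..nsite D}" "j \<in> {1..ncat D}" for i j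
      using \<open>good \<omega>\<close> that by (auto simp: good_def q_def)
    have "(\<lambda>N. q N i j * ln (q N i j / (\<Sum>k = 1..ncat D. q N i k))) \<longlonglongrightarrow> w i * \<pi> i j * ln (\<pi> i j)"
      if ij: "i \<in> {1..nsite D}" "j \<in> {1..ncat D}" for i j
    proof -
      have "(\<lambda>N. \<Sum>k = 1..ncat D. q N i k) \<longlonglongrightarrow> (\<Sum>k = 1..ncat D. w i * \<pi> i k)"
        using ij by (intro tendsto_sum q) auto
      also have "(\<Sum>k = 1..ncat D. w i * \<pi> i k) = w i"
        using \<pi>(2)[OF ij(1)] by (simp flip: sum_distrib_left)
      \<comment> \<open>The limits \<open>w i\<close> of the denominator and
        \<open>\<pi> i j\<close> of the quotient are positive, so division and \<open>ln\<close> are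
        continuous there; zero frequencies at small \<open>N\<close> do no harm.\<close>
      finally have "(\<lambda>N. q N i j * ln (q N i j / (\<Sum>k = 1..ncat D. q N i k)))
          \<longlonglongrightarrow> w i * \<pi> i j * ln (w i * \<pi> i j / w i)"
        using w[OF ij(1)] \<pi>(1)[OF ij] by (intro tendsto_intros q ij) auto
      then show ?thesis using w[OF ij(1)] by simp
    qed
    then show "(\<lambda>N. \<Sum>i = 1..nsite D. \<Sum>j = 1..ncat D.
        q N i j * ln (q N i j / (\<Sum>k = 1..ncat D. q N i k))) \<longlonglongrightarrow> l0"
      unfolding l0 by (intro tendsto_sum) auto
    show "\<forall>\<^sub>F N in sequentially. lN N \<omega> (mle N \<omega>) / real N \<le> (\<Sum>i = 1..nsite D. \<Sum>j = 1..ncat D.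
        q N i j * ln (q N i j / (\<Sum>k = 1..ncat D. q N i k)))"
      using \<open>good \<omega>\<close> loglik_le_empirical[OF J] by (auto simp: good_def lN_def q_def)
    show "\<forall>\<^sub>F N in sequentially. lN N \<omega> (\<theta>\<^sub>0, \<sigma>\<^sub>0) / real N \<le> lN N \<omega> (mle N \<omega>) / real N"
      using \<open>good \<omega>\<close> by (auto simp: good_def elim!: eventually_mono intro: divide_right_mono)
  qed
  have "(\<lambda>N. \<bar>lN N \<omega> (mle N \<omega>) - lN N \<omega> (\<theta>\<^sub>0, \<sigma>\<^sub>0)\<bar> / real N) \<longlonglongrightarrow> 0" if "good \<omega>" for \<omega>
    using tendsto_rabs[OF tendsto_diff[OF mle_lim[OF that] true_lim[OF that]]]
    by (simp add: abs_divide flip: diff_divide_distrib)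
  moreover have "(\<lambda>N. lN N \<omega> (\<theta>\<^sub>0, \<sigma>\<^sub>0) / lN N \<omega> (mle N \<omega>)) \<longlonglongrightarrow> 1" if "good \<omega>" for \<omega>
  proof -
    \<comment> \<open>Numerator and denominator are each divided by \<open>N\<close> to reach the
      common nonzero limit \<open>l0\<close>; the factor cancels for \<open>N > 0\<close>.\<close>
    have "(\<lambda>N. (lN N \<omega> (\<theta>\<^sub>0, \<sigma>\<^sub>0) / real N) / (lN N \<omega> (mle N \<omega>) / real N)) \<longlonglongrightarrow> l0 / l0"
      using \<open>l0 < 0\<close> by (intro tendsto_divide true_lim mle_lim that) simp
    moreover have "\<forall>\<^sub>F N in sequentially. (lN N \<omega> (\<theta>\<^sub>0, \<sigma>\<^sub>0) / real N) / (lN N \<omega> (mle N \<omega>) / real N)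
        = lN N \<omega> (\<theta>\<^sub>0, \<sigma>\<^sub>0) / lN N \<omega> (mle N \<omega>)"
      using eventually_gt_at_top[of 0] by eventually_elim simp
    ultimately have "(\<lambda>N. lN N \<omega> (\<theta>\<^sub>0, \<sigma>\<^sub>0) / lN N \<omega> (mle N \<omega>)) \<longlonglongrightarrow> l0 / l0"
      by (rule Lim_transform_eventually)
    then show ?thesis using \<open>l0 < 0\<close> by simp
  qed
  ultimately show ?thesis
    using AE_good mle_lim by (auto elim: eventually_mono)
qed

end
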